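(* Let $\mathcal{X}$ be a non-empty finite set. Given a time consistent family of exchangeable coherent lower previsions $\underline{P}^n$ on $\mathcal{L}(\mathcal{X}^n)$, $n\geq1$, with count distributions $\underline{Q}^n$ on $\mathcal{L}(\mathcal{N}^n)$, there is a unique coherent lower prevision $\underline{R}$ on the linear space $\mathcal{V}(\Sigma)$ of all polynomial gambles on the $\mathcal{X}$-simplex $\Sigma$ such that for all $n\geq1$, all $f\in\mathcal{L}(\mathcal{X}^n)$ and all $g\in\mathcal{L}(\mathcal{N}^n)$: $$\underline{P}^n(f)=\underline{R}(\mathrm{Mn}^n(f|\cdot))\quad\text{and}\quad\underline{Q}^n(g)=\underline{R}(\mathrm{CoMn}^n(g|\cdot)).$$
   Context: A gamble on a non-empty set $\mathcal{Z}$ is a bounded map $\mathcal{Z}\to\mathbb{R}$; $\mathcal{L}(\mathcal{Z})$ is the linear space of all gambles on $\mathcal{Z}$. A lower prevision on a set of gambles is a real-valued functional on it. A lower prevision $\underline{P}$ on a linear space of gambles $\mathcal{K}$ is coherent iff for all $f,g\in\mathcal{K}$ and real $\lambda\geq0$: $\underline{P}(f)\geq\inf f$; $\underline{P}(\lambda f)=\lambda\underline{P}(f)$; $\underline{P}(f+g)\geq\underline{P}(f)+\underline{P}(g)$. A coherent lower prevision $\underline{P}^n$ on $\mathcal{L}(\mathcal{X}^n)$ is exchangeable if $\underline{P}^n(\pi f-f)\geq0$ for all gambles $f$ on $\mathcal{X}^n$ and all permutations $\pi$ of $\{1,\dots,n\}$, where $(\pi f)(x_1,\dots,x_n):=f(x_{\pi(1)},\dots,x_{\pi(n)})$.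 A family $\underline{P}^n$, $n\geq1$, is time consistent if $\underline{P}^n(f)=\underline{P}^{n+k}(\tilde f)$ for all $n\geq1$, $k\geq0$ and all gambles $f$ on $\mathcal{X}^n$, where $\tilde f(z_1,\dots,z_{n+k}):=f(z_1,\dots,z_n)$. The set of count vectors is $\mathcal{N}^n:=\{\mathbf{m}\in\mathbb{Z}_{\geq0}^{\mathcal{X}}:\sum_{x\in\mathcal{X}}m_x=n\}$. The counting map $\mathbf{T}^n:\mathcal{X}^n\to\mathcal{N}^n$ has components $T^n_x(\mathbf{z}):=|\{k:z_k=x\}|$. The count distribution of $\underline{P}^n$ is the coherent lower prevision $\underline{Q}^n(h):=\underline{P}^n(h\circ\mathbf{T}^n)$ on $\mathcal{L}(\mathcal{N}^n)$. For $\mathbf{m}\in\mathcal{N}^n$, $\nu(\mathbf{m}):=n!/\prod_{x\in\mathcal{X}}m_x!$. The $\mathcal{X}$-simplex is $\Sigma:=\{\theta\in\mathbb{R}^{\mathcal{X}}:\theta_x\geq0\text{ for all }x\in\mathcal{X},\ \sum_{x\in\mathcal{X}}\theta_x=1\}$. For $\theta\in\Sigma$ (with $a^0=1$ for all $a\ge 0$), $$\mathrm{Mn}^n(f|\theta):=\sum_{\mathbf{z}\in\mathcal{X}^n}f(\mathbf{z})\prod_{x\in\mathcal{X}}\theta_x^{T^n_x(\mathbf{z})},\qquad \mathrm{CoMn}^n(g|\theta):=\sum_{\mathbf{m}\in\mathcal{N}^n}g(\mathbf{m})\,\nu(\mathbf{m})\prod_{x\in\mathcal{X}}\theta_x^{m_x}.$$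 $\mathcal{V}(\Sigma)$ is the linear space of all polynomial functions on $\Sigma$; it equals $\{\mathrm{CoMn}^n(g|\cdot):n\geq1,\ g\in\mathcal{L}(\mathcal{N}^n)\}=\{\mathrm{Mn}^n(f|\cdot):n\geq1,\ f\in\mathcal{L}(\mathcal{X}^n)\}$. *)

theory Defs
  imports "HOL-Analysis.Analysis"
begin

text \<open>
  A map on a set \<open>Z\<close> is represented by a total function that takes the value \<open>undefined\<close>
  outside \<open>Z\<close>, so that two maps on \<open>Z\<close> are equal iff they agree on \<open>Z\<close>.
\<close>

definition gambles :: "'z set \<Rightarrow> ('z \<Rightarrow> real) set" where
  "gambles Z = {f \<in> extensional Z. bounded (f ` Z)}"

definition linear_space_of_gambles :: "'z set \<Rightarrow> ('z \<Rightarrow> real) set \<Rightarrow> bool" where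
  "linear_space_of_gambles Z K \<longleftrightarrow>
     K \<subseteq> gambles Z \<and>
     (\<lambda>z\<in>Z. 0) \<in> K \<and>
     (\<forall>f\<in>K. \<forall>g\<in>K. (\<lambda>z\<in>Z. f z + g z) \<in> K) \<and>
     (\<forall>f\<in>K. \<forall>c::real. (\<lambda>z\<in>Z. c * f z) \<in> K)"

definition coherent_lower_prevision ::
    "'z set \<Rightarrow> ('z \<Rightarrow> real) set \<Rightarrow> (('z \<Rightarrow> real) \<Rightarrow> real) \<Rightarrow> bool" where
  "coherent_lower_prevision Z K P \<longleftrightarrow>
     linear_space_of_gambles Z K \<and>
     (\<forall>f\<in>K. P f \<ge> (INF z\<in>Z. f z)) \<and>
     (\<forall>f\<in>K. \<forall>c\<ge>0. P (\<lambda>z\<in>Z. c * f z) = c * P f) \<and>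
     (\<forall>f\<in>K. \<forall>g\<in>K. P (\<lambda>z\<in>Z. f z + g z) \<ge> P f + P g)"

text \<open>
  The finite type \<open>'x\<close> plays the role of the non-empty finite set of categories.
  The elements of its \<open>n\<close>-th power are the functions from \<open>{1..n}\<close> to \<open>'x\<close>.
\<close>

definition samples :: "nat \<Rightarrow> (nat \<Rightarrow> 'x::finite) set" where
  "samples n = {1..n} \<rightarrow>\<^sub>E UNIV"

definition permute_gamble ::
    "nat \<Rightarrow> (nat \<Rightarrow> nat) \<Rightarrow> ((nat \<Rightarrow> 'x::finite) \<Rightarrow> real) \<Rightarrow> (nat \<Rightarrow> 'x) \<Rightarrow> real" where
  "permute_gamble n \<pi> f = (\<lambda>z\<in>samples n. f (\<lambda>k\<in>{1..n}. z (\<pi> k)))"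

definition exchangeable :: "nat \<Rightarrow> (((nat \<Rightarrow> 'x::finite) \<Rightarrow> real) \<Rightarrow> real) \<Rightarrow> bool" where
  "exchangeable n P \<longleftrightarrow>
     (\<forall>f\<in>gambles (samples n). \<forall>\<pi>. \<pi> permutes {1..n} \<longrightarrow>
        P (\<lambda>z\<in>samples n. permute_gamble n \<pi> f z - f z) \<ge> 0)"

definition cylindrical_extension ::
    "nat \<Rightarrow> nat \<Rightarrow> ((nat \<Rightarrow> 'x::finite) \<Rightarrow> real) \<Rightarrow> (nat \<Rightarrow> 'x) \<Rightarrow> real" where
  "cylindrical_extension n k f = (\<lambda>z\<in>samples (n + k). f (restrict z {1..n}))"

definition time_consistent :: "(nat \<Rightarrow> ((nat \<Rightarrow> 'x::finite) \<Rightarrow> real) \<Rightarrow> real) \<Rightarrow> bool" where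
  "time_consistent P \<longleftrightarrow>
     (\<forall>n\<ge>1. \<forall>k. \<forall>f\<in>gambles (samples n).
        P n f = P (n + k) (cylindrical_extension n k f))"

definition count_vectors :: "nat \<Rightarrow> ('x::finite \<Rightarrow> nat) set" where
  "count_vectors n = {m. (\<Sum>x\<in>UNIV. m x) = n}"

definition counting_map :: "nat \<Rightarrow> (nat \<Rightarrow> 'x::finite) \<Rightarrow> 'x \<Rightarrow> nat" where
  "counting_map n z = (\<lambda>x. card {k \<in> {1..n}. z k = x})"

definition count_distribution ::
    "nat \<Rightarrow> (((nat \<Rightarrow> 'x::finite) \<Rightarrow> real) \<Rightarrow> real) \<Rightarrow> (('x \<Rightarrow> nat) \<Rightarrow> real) \<Rightarrow> real" where
  "count_distribution n P =
     (\<lambda>h\<in>gambles (count_vectors n). P (\<lambda>z\<in>samples n. h (counting_map n z)))"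

definition multinomial_coeff :: "nat \<Rightarrow> ('x::finite \<Rightarrow> nat) \<Rightarrow> real" where
  "multinomial_coeff n m = fact n / (\<Prod>x\<in>UNIV. fact (m x))"

definition prob_simplex :: "(real ^ 'x::finite) set" where
  "prob_simplex = {\<theta>. (\<forall>x. \<theta> $ x \<ge> 0) \<and> (\<Sum>x\<in>UNIV. \<theta> $ x) = 1}"

definition Mn :: "nat \<Rightarrow> ((nat \<Rightarrow> 'x::finite) \<Rightarrow> real) \<Rightarrow> real ^ 'x \<Rightarrow> real" where
  "Mn n f = (\<lambda>\<theta>\<in>prob_simplex.
     \<Sum>z\<in>samples n. f z * (\<Prod>x\<in>UNIV. (\<theta> $ x) ^ counting_map n z x))"

definition CoMn :: "nat \<Rightarrow> (('x::finite \<Rightarrow> nat) \<Rightarrow> real) \<Rightarrow> real ^ 'x \<Rightarrow> real" where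
  "CoMn n g = (\<lambda>\<theta>\<in>prob_simplex.
     \<Sum>m\<in>count_vectors n. g m * multinomial_coeff n m * (\<Prod>x\<in>UNIV. (\<theta> $ x) ^ m x))"

definition polynomial_gambles :: "(real ^ 'x::finite \<Rightarrow> real) set" where
  "polynomial_gambles = {restrict p prob_simplex | p. real_polynomial_function p}"

end

theory Submission
  imports Defs "HOL-Combinatorics.Multiset_Permutations"
begin

text \<open>
  Necessarily \<open>R (Mn n f) = P n f\<close>, and every polynomial gamble is of the form \<open>Mn n f\<close>
  (\<open>polynomial_gambles_eq_Mn\<close>), so \<open>R\<close> is unique. For existence, the point is the inequality

    \<open>P n f \<ge> inf over the simplex of Mn n f\<close>     (\<open>time_consistent_exchangeable_ge_inf_Mn\<close>).

  It is obtained from an urn. Extend \<open>f\<close> to \<open>N \<ge> n\<close> observations, which preserves its lower prevision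
  by time consistency. For a map \<open>\<sigma>\<close> from \<open>{1..n}\<close> to \<open>{1..N}\<close>, let \<open>f\<^sub>\<sigma>\<close> be the gamble that
  evaluates \<open>f\<close> at the observations with numbers \<open>\<sigma> 1, \<dots>, \<sigma> n\<close>. The average of \<open>f\<^sub>\<sigma>\<close> over all maps
  \<open>\<sigma>\<close> is the expectation of \<open>f\<close> when drawing with replacement from the \<open>N\<close> observations. This is the
  value of \<open>Mn n f\<close> at the empirical frequencies, a point of the simplex, so the average is pointwise
  at least the infimum. By exchangeability, replacing \<open>f\<close> by \<open>f\<^sub>\<sigma>\<close> costs nothing if \<open>\<sigma>\<close> is injective,
  that is, if the draw is without replacement. The maps that are not injective form a fraction of at
  most \<open>n\<^sup>2 / N\<close> of all maps, so their total cost tends to \<open>0\<close> as \<open>N\<close> grows.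

  Everything else follows formally. If \<open>Mn n f \<le> Mn m g\<close> on the simplex, extend both gambles to length
  \<open>n + m\<close> and apply the inequality to their difference; superadditivity gives \<open>P n f \<le> P m g\<close>. So
  \<open>R (Mn n f) = P n f\<close> is a consistent definition of \<open>R\<close>. Coherence of \<open>R\<close> is inherited: its lower
  bound is the inequality itself, and the other two axioms hold for representatives of a common
  length. Finally, \<open>CoMn n g\<close> is \<open>Mn n\<close> of the
  composition of \<open>g\<close> with the counting map, because the multinomial coefficient counts the samples with
  given counts, and this covers the count distributions.
\<close>

section \<open>Expectations under independent sampling\<close>

lemma finite_samples [simp]: "finite (samples n :: (nat \<Rightarrow> 'x::finite) set)"
  by (simp add: samples_def finite_PiE)

lemma samples_nonempty [simp]: "samples n \<noteq> ({} :: (nat \<Rightarrow> 'x::finite) set)"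
  by (simp add: samples_def PiE_eq_empty_iff)

lemma restrict_in_samples: "(\<lambda>k\<in>{1..n}. z k) \<in> samples n"
  by (auto simp: samples_def)

lemma gambles_finite: "finite Z \<Longrightarrow> gambles Z = extensional Z"
  by (auto simp: gambles_def)

text \<open>
  Grouping the positions of a sample by category turns the monomial in the counts into a product
  over positions. This form of the multinomial weights factorises under concatenation of samples,
  which is what the lemmas below exploit.
\<close>
lemma prod_counting_map:
  fixes z :: "nat \<Rightarrow> 'x::finite" and t :: "'x \<Rightarrow> real"
  shows "(\<Prod>x\<in>UNIV. t x ^ counting_map n z x) = (\<Prod>k=1..n. t (z k))"
proof -
  have "(\<Prod>x\<in>UNIV. t x ^ counting_map n z x) = (\<Prod>x\<in>UNIV. \<Prod>k\<in>{k\<in>{1..n}. z k = x}. t (z k))"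
    by (simp add: counting_map_def)
  also have "\<dots> = (\<Prod>k=1..n. t (z k))"
    by (rule prod.group) auto
  finally show ?thesis .
qed

lemma Mn_eq_sum_prod:
  "\<theta> \<in> prob_simplex \<Longrightarrow> Mn n f \<theta> = (\<Sum>z\<in>samples n. f z * (\<Prod>k=1..n. \<theta> $ z k))"
  by (simp add: Mn_def prod_counting_map)

lemma Mn_extensional: "Mn n f \<in> extensional prob_simplex"
  by (simp add: Mn_def)

lemma sum_sample_probabilities:
  assumes "\<theta> \<in> prob_simplex"
  shows "(\<Sum>z\<in>samples n. \<Prod>k=1..n. \<theta> $ z k) = 1"
proof -
  have "(\<Prod>k=1..n. \<Sum>x\<in>UNIV. \<theta> $ x) = (\<Sum>z\<in>samples n. \<Prod>k=1..n. \<theta> $ z k)"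
    unfolding samples_def by (rule prod_sum_PiE) auto
  then show ?thesis
    using assms by (simp add: prob_simplex_def)
qed

text \<open>
  Independence: a sample of length \<open>n + m\<close> splits uniquely into its first \<open>n\<close> and its last \<open>m\<close>
  observations, and its weight is the product of the weights of the two parts. The case \<open>g = 1\<close>
  says that \<open>Mn\<close> ignores cylindrical extension; the general case yields products of polynomials.
\<close>
lemma Mn_concat:
  fixes f g :: "(nat \<Rightarrow> 'x::finite) \<Rightarrow> real"
  assumes "\<theta> \<in> prob_simplex"
  shows "Mn (n + m) (\<lambda>z\<in>samples (n + m). f (restrict z {1..n}) * g (\<lambda>k\<in>{1..m}. z (n + k))) \<theta>
       = Mn n f \<theta> * Mn m g \<theta>"
proof -
  let ?w = "\<lambda>n z. \<Prod>k=1..n. \<theta> $ z k"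
  have "Mn n f \<theta> * Mn m g \<theta> =
      (\<Sum>(a, b)\<in>samples n \<times> samples m. (f a * ?w n a) * (g b * ?w m b))"
    by (simp add: Mn_eq_sum_prod assms sum_product sum.cartesian_product)
  also have "\<dots> = (\<Sum>z\<in>samples (n + m).
      (f (restrict z {1..n}) * g (\<lambda>k\<in>{1..m}. z (n + k))) * ?w (n + m) z)"
  proof (rule sum.reindex_bij_witness[where
        i = "\<lambda>z. (restrict z {1..n}, \<lambda>k\<in>{1..m}. z (n + k))" and
        j = "\<lambda>(a, b). \<lambda>k\<in>{1..n + m}. if k \<le> n then a k else b (k - n)"], goal_cases)
    case (1 p)
    then show ?case
      by (auto simp: samples_def PiE_def extensional_def fun_eq_iff)
  next
    case (3 z)
    then show ?case
      by (auto simp: samples_def PiE_def extensional_def fun_eq_iff)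
  next
    case (5 p)
    obtain a b where p: "p = (a, b)" and ab: "a \<in> samples n" "b \<in> samples m"
      using 5 by auto
    let ?z = "\<lambda>k\<in>{1..n + m}. if k \<le> n then a k else b (k - n)"
    have a: "restrict ?z {1..n} = a" and b: "(\<lambda>k\<in>{1..m}. ?z (n + k)) = b"
      using ab by (auto simp: samples_def PiE_def extensional_def fun_eq_iff)
    have "?w (n + m) ?z = (\<Prod>k=1..n. \<theta> $ ?z k) * (\<Prod>k=1..m. \<theta> $ ?z (n + k))"
      using prod.ub_add_nat[of 1 n "\<lambda>k. \<theta> $ ?z k" m]
        prod.shift_bounds_cl_nat_ivl[of "\<lambda>k. \<theta> $ ?z k" 1 n m]
      by (simp add: add.commute)
    also have "\<dots> = ?w n a * ?w m b"
      by (intro arg_cong2[of _ _ _ _ "(*)"] prod.cong) auto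
    finally show ?case
      unfolding p prod.case a b by simp
  qed (auto simp: restrict_in_samples[simplified])
  also have "\<dots> = Mn (n + m) (\<lambda>z\<in>samples (n + m).
      f (restrict z {1..n}) * g (\<lambda>k\<in>{1..m}. z (n + k))) \<theta>"
    by (simp add: Mn_eq_sum_prod assms)
  finally show ?thesis ..
qed

lemma Mn_const: "\<theta> \<in> prob_simplex \<Longrightarrow> Mn n (\<lambda>z\<in>samples n. c) \<theta> = c"
  by (simp add: Mn_eq_sum_prod sum_sample_probabilities[simplified] flip: sum_distrib_left)

lemma Mn_cylindrical_extension:
  fixes f :: "(nat \<Rightarrow> 'x::finite) \<Rightarrow> real"
  shows "Mn (n + k) (cylindrical_extension n k f) = Mn n f"
proof
  fix \<theta> :: "real ^ 'x"
  show "Mn (n + k) (cylindrical_extension n k f) \<theta> = Mn n f \<theta>"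
  proof (cases "\<theta> \<in> prob_simplex")
    case True
    have "cylindrical_extension n k f =
        (\<lambda>z\<in>samples (n + k). f (restrict z {1..n}) * (\<lambda>z\<in>samples k. 1) (\<lambda>i\<in>{1..k}. z (n + i)))"
      unfolding cylindrical_extension_def
      by (rule restrict_ext) (simp add: restrict_in_samples[simplified])
    with Mn_concat[OF True, of n k f "\<lambda>z\<in>samples k. 1"] show ?thesis
      by (simp add: Mn_const[OF True])
  qed (simp add: Mn_def)
qed

lemma Mn_add:
  "\<theta> \<in> prob_simplex \<Longrightarrow> Mn n (\<lambda>z\<in>samples n. f z + g z) \<theta> = Mn n f \<theta> + Mn n g \<theta>"
  by (simp add: Mn_eq_sum_prod algebra_simps sum.distrib)

lemma Mn_diff:
  "\<theta> \<in> prob_simplex \<Longrightarrow> Mn n (\<lambda>z\<in>samples n. f z - g z) \<theta> = Mn n f \<theta> - Mn n g \<theta>"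
  by (simp add: Mn_eq_sum_prod algebra_simps sum_subtractf)

lemma Mn_scale:
  "\<theta> \<in> prob_simplex \<Longrightarrow> Mn n (\<lambda>z\<in>samples n. c * f z) \<theta> = c * Mn n f \<theta>"
  by (simp add: Mn_eq_sum_prod sum_distrib_left mult.assoc)

text \<open>
  The weights are products of probabilities, hence at most \<open>1\<close>. This rough bound suffices to make
  every \<open>Mn n f\<close> a gamble.
\<close>
lemma Mn_bounded:
  assumes "\<theta> \<in> prob_simplex"
  shows "\<bar>Mn n f \<theta>\<bar> \<le> (\<Sum>z\<in>samples n. \<bar>f z\<bar>)"
proof -
  have \<theta>: "0 \<le> \<theta> $ x" "\<theta> $ x \<le> 1" for x
  proof -
    show nonneg: "0 \<le> \<theta> $ x" for x
      using assms by (simp add: prob_simplex_def)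
    have "\<theta> $ x \<le> (\<Sum>x\<in>UNIV. \<theta> $ x)"
      by (rule member_le_sum) (use nonneg in auto)
    then show "\<theta> $ x \<le> 1"
      using assms by (simp add: prob_simplex_def)
  qed
  have "\<bar>f z * (\<Prod>k=1..n. \<theta> $ z k)\<bar> \<le> \<bar>f z\<bar>" for z
    by (simp add: abs_mult abs_prod \<theta> mult_left_le prod_le_1)
  then show ?thesis
    unfolding Mn_eq_sum_prod[OF assms]
    by (intro order_trans[OF sum_abs] sum_mono)
qed

section \<open>Count vectors\<close>

text \<open>
  Writing a sample as a list identifies the samples with counts \<open>m\<close> with the orderings of the
  multiset that contains each category \<open>x\<close> exactly \<open>m x\<close> times.
\<close>
lemma card_counting_map_fibre:
  assumes "m \<in> count_vectors n"
  shows "real (card {z \<in> samples n. counting_map n z = m}) = multinomial_coeff n m"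
proof -
  define A where "A = Abs_multiset m"
  have count_A [simp]: "count A = m"
    by (simp add: A_def Abs_multiset_inverse)
  have size_A: "size A = n"
  proof -
    have "size A = (\<Sum>x\<in>UNIV. m x)"
      unfolding size_multiset_overloaded_eq
      by (rule sum.mono_neutral_cong_left) (auto simp: not_in_iff)
    then show ?thesis
      using assms by (simp add: count_vectors_def)
  qed
  have count_list: "count (mset (map z [1..<Suc n])) x = counting_map n z x" for z x
  proof -
    have "mset (map z [1..<Suc n]) = image_mset z (mset_set {1..n})"
      by (simp add: atLeastLessThanSuc_atLeastAtMost del: upt_Suc)
    then have "count (mset (map z [1..<Suc n])) x = (\<Sum>k\<in>z -` {x} \<inter> {1..n}. 1)"
      by (simp add: count_image_mset)
    also have "z -` {x} \<inter> {1..n} = {k \<in> {1..n}. z k = x}"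
      by auto
    finally show ?thesis
      by (simp add: counting_map_def)
  qed
  have "bij_betw (\<lambda>z. map z [1..<Suc n]) {z \<in> samples n. counting_map n z = m}
      (permutations_of_multiset A)"
  proof (rule bij_betw_byWitness[where f' = "\<lambda>xs. \<lambda>k\<in>{1..n}. xs ! (k - 1)"])
    show "\<forall>z\<in>{z \<in> samples n. counting_map n z = m}.
        (\<lambda>k\<in>{1..n}. map z [1..<Suc n] ! (k - 1)) = z"
      by (auto simp: samples_def PiE_def extensional_def fun_eq_iff simp del: upt_Suc)
    have map_nth: "map (\<lambda>k\<in>{1..n}. xs ! (k - 1)) [1..<Suc n] = xs" if "length xs = n" for xs :: "'a list"
      using that by (auto intro!: nth_equalityI simp del: upt_Suc)
    then show "\<forall>xs\<in>permutations_of_multiset A.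
        map (\<lambda>k\<in>{1..n}. xs ! (k - 1)) [1..<Suc n] = xs"
      using size_A length_finite_permutations_of_multiset by metis
    show "(\<lambda>z. map z [1..<Suc n]) ` {z \<in> samples n. counting_map n z = m}
        \<subseteq> permutations_of_multiset A"
      using count_list by (auto intro!: permutations_of_multisetI multiset_eqI simp del: upt_Suc mset_map)
    show "(\<lambda>xs. \<lambda>k\<in>{1..n}. xs ! (k - 1)) ` permutations_of_multiset A
        \<subseteq> {z \<in> samples n. counting_map n z = m}"
    proof (rule image_subsetI)
      fix xs assume xs: "xs \<in> permutations_of_multiset A"
      let ?z = "\<lambda>k\<in>{1..n}. xs ! (k - 1)"
      have "map ?z [1..<Suc n] = xs"
        using map_nth length_finite_permutations_of_multiset[OF xs] size_A by simp
      then have "counting_map n ?z x = m x" for x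
        using count_list[of ?z x] permutations_of_multisetD[OF xs] by simp
      then show "?z \<in> {z \<in> samples n. counting_map n z = m}"
        using restrict_in_samples by auto
    qed
  qed
  then have card_eq: "card {z \<in> samples n. counting_map n z = m} = card (permutations_of_multiset A)"
    by (rule bij_betw_same_card)
  have "(\<Prod>x\<in>set_mset A. fact (count A x)) = (\<Prod>x\<in>UNIV. fact (m x) :: nat)"
    by (rule prod.mono_neutral_cong_left) (auto simp: not_in_iff)
  then have "card (permutations_of_multiset A) * (\<Prod>x\<in>UNIV. fact (m x)) = fact n"
    using card_permutations_of_multiset_aux[of A] size_A by simp
  then have "real (card (permutations_of_multiset A) * (\<Prod>x\<in>UNIV. fact (m x))) = fact n"
    by simp
  then show ?thesis
    by (simp add: multinomial_coeff_def card_eq field_simps)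
qed

lemma counting_map_in_count_vectors: "counting_map n z \<in> count_vectors n"
proof -
  have "(\<Sum>x\<in>UNIV. \<Sum>k\<in>{k\<in>{1..n}. z k = x}. 1) = (\<Sum>k=1..n. 1 :: nat)"
    by (rule sum.group) auto
  then show ?thesis
    by (simp add: counting_map_def count_vectors_def)
qed

lemma counting_map_samples:
  "counting_map n ` samples n = (count_vectors n :: ('x::finite \<Rightarrow> nat) set)"
proof
  show "counting_map n ` samples n \<subseteq> (count_vectors n :: ('x \<Rightarrow> nat) set)"
    using counting_map_in_count_vectors by auto
  show "(count_vectors n :: ('x \<Rightarrow> nat) set) \<subseteq> counting_map n ` samples n"
  proof
    fix m :: "'x \<Rightarrow> nat" assume "m \<in> count_vectors n"
    then have "real (card {z \<in> samples n. counting_map n z = m}) > 0"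
      by (simp add: card_counting_map_fibre multinomial_coeff_def prod_pos)
    then have "{z \<in> samples n. counting_map n z = m} \<noteq> {}"
      by (metis card.empty of_nat_0 less_irrefl)
    then show "m \<in> counting_map n ` samples n"
      by auto
  qed
qed

text \<open>
  All samples with the same counts have the same weight, and \<open>multinomial_coeff\<close> is the number of
  them. So the representation of the count distributions is a special case of that of the previsions.
\<close>
lemma CoMn_eq_Mn:
  fixes g :: "('x::finite \<Rightarrow> nat) \<Rightarrow> real"
  shows "CoMn n g = Mn n (\<lambda>z\<in>samples n. g (counting_map n z))"
proof
  fix \<theta> :: "real ^ 'x"
  show "CoMn n g \<theta> = Mn n (\<lambda>z\<in>samples n. g (counting_map n z)) \<theta>"
  proof (cases "\<theta> \<in> prob_simplex")
    case True
    let ?h = "\<lambda>m. g m * (\<Prod>x\<in>UNIV. \<theta> $ x ^ m x)"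
    have "CoMn n g \<theta> =
        (\<Sum>m\<in>count_vectors n. real (card {z \<in> samples n. counting_map n z = m}) * ?h m)"
      using True by (simp add: CoMn_def card_counting_map_fibre mult_ac)
    also have "\<dots> = (\<Sum>z\<in>samples n. ?h (counting_map n z))"
      by (rule sum_fun_comp[symmetric])
        (auto simp: counting_map_in_count_vectors simp flip: counting_map_samples)
    finally show ?thesis
      using True by (simp add: Mn_def)
  qed (simp add: Mn_def CoMn_def)
qed

section \<open>Coherent lower previsions\<close>

lemma coherent_ge_lower_bound:
  assumes "coherent_lower_prevision Z K P" "Z \<noteq> {}" "f \<in> K" "\<And>z. z \<in> Z \<Longrightarrow> c \<le> f z"
  shows "c \<le> P f"
proof -
  have "c \<le> (INF z\<in>Z. f z)"
    using assms by (intro cINF_greatest) auto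
  also have "\<dots> \<le> P f"
    using assms by (simp add: coherent_lower_prevision_def)
  finally show ?thesis .
qed

lemma coherent_scale:
  "coherent_lower_prevision Z K P \<Longrightarrow> f \<in> K \<Longrightarrow> 0 \<le> c \<Longrightarrow> P (\<lambda>z\<in>Z. c * f z) = c * P f"
  by (simp add: coherent_lower_prevision_def)

lemma coherent_superadditive:
  "coherent_lower_prevision Z K P \<Longrightarrow> f \<in> K \<Longrightarrow> g \<in> K \<Longrightarrow> P f + P g \<le> P (\<lambda>z\<in>Z. f z + g z)"
  by (simp add: coherent_lower_prevision_def)

lemma coherent_superadditive_sum:
  assumes coh: "coherent_lower_prevision Z K P"
    and "finite I" and "\<And>i. i \<in> I \<Longrightarrow> h i \<in> K"
  shows "(\<lambda>z\<in>Z. \<Sum>i\<in>I. h i z) \<in> K \<and> (\<Sum>i\<in>I. P (h i)) \<le> P (\<lambda>z\<in>Z. \<Sum>i\<in>I. h i z)"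
  using assms(2,3)
proof (induction I rule: finite_induct)
  case empty
  have zero: "(\<lambda>z\<in>Z. 0) \<in> K"
    using coh by (simp add: coherent_lower_prevision_def linear_space_of_gambles_def)
  have "(\<lambda>z\<in>Z. 0 * (\<lambda>z\<in>Z. 0) z) = (\<lambda>z\<in>Z. 0 :: real)"
    by auto
  then have "P (\<lambda>z\<in>Z. 0) = 0"
    using coherent_scale[OF coh zero, of 0] by simp
  with zero show ?case
    by (simp del: restrict_apply)
next
  case (insert i I)
  let ?s = "\<lambda>z\<in>Z. \<Sum>i\<in>I. h i z"
  have IH: "?s \<in> K" "(\<Sum>i\<in>I. P (h i)) \<le> P ?s" and h: "h i \<in> K"
    using insert.IH insert.prems by blast+
  have eq: "(\<lambda>z\<in>Z. \<Sum>i\<in>insert i I. h i z) = (\<lambda>z\<in>Z. h i z + ?s z)"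
    using insert.hyps by (intro restrict_ext) simp
  have "(\<lambda>z\<in>Z. h i z + ?s z) \<in> K"
    using coh h IH(1) unfolding coherent_lower_prevision_def linear_space_of_gambles_def by blast
  moreover have "P (h i) + P ?s \<le> P (\<lambda>z\<in>Z. h i z + ?s z)"
    by (rule coherent_superadditive[OF coh h IH(1)])
  ultimately show ?case
    unfolding eq using insert.hyps IH(2) by (simp del: restrict_apply)
qed

section \<open>Sampling with and without replacement\<close>

text \<open>
  The union bound behind the birthday problem: a map that is not injective identifies some pair
  \<open>i \<noteq> j\<close>, and it is then determined by its values off \<open>i\<close>. Multiplying through by \<open>card B\<close> keeps
  the estimate in the natural numbers; divided by \<open>card B ^ (card A + 1)\<close> it says that a random map
  fails to be injective with probability at most \<open>(card A)\<^sup>2 / card B\<close>.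
\<close>
lemma card_noninjective_le:
  assumes "finite A" "finite B"
  shows "card {\<sigma> \<in> A \<rightarrow>\<^sub>E B. \<not> inj_on \<sigma> A} * card B \<le> (card A)\<^sup>2 * card B ^ card A"
proof -
  let ?C = "\<lambda>(i, j). {\<sigma> \<in> A \<rightarrow>\<^sub>E B. \<sigma> i = \<sigma> j}"
  let ?D = "{p \<in> A \<times> A. fst p \<noteq> snd p}"
  have fin: "finite (A \<rightarrow>\<^sub>E B)"
    using assms by (simp add: finite_PiE)
  have card_C: "card (?C p) * card B \<le> card B ^ card A" if "p \<in> ?D" for p
  proof -
    obtain i j where p: "p = (i, j)" and ij: "i \<in> A" "j \<in> A" "i \<noteq> j"
      using \<open>p \<in> ?D\<close> by (cases p) auto
    have "inj_on (\<lambda>\<sigma>. restrict \<sigma> (A - {i})) (?C (i, j))"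
    proof (rule inj_onI)
      fix \<sigma> \<tau> assume \<sigma>\<tau>: "\<sigma> \<in> ?C (i, j)" "\<tau> \<in> ?C (i, j)" "restrict \<sigma> (A - {i}) = restrict \<tau> (A - {i})"
      have eq: "\<sigma> k = \<tau> k" if "k \<in> A - {i}" for k
        using fun_cong[OF \<sigma>\<tau>(3), of k] that by simp
      have "\<sigma> k = \<tau> k" if "k \<in> A" for k
        using eq[of k] eq[of j] that ij \<sigma>\<tau>(1,2) by (cases "k = i") auto
      moreover have "\<sigma> \<in> A \<rightarrow>\<^sub>E B" "\<tau> \<in> A \<rightarrow>\<^sub>E B"
        using \<sigma>\<tau>(1,2) by auto
      ultimately show "\<sigma> = \<tau>"
        by (blast intro: PiE_ext)
    qed
    moreover have "(\<lambda>\<sigma>. restrict \<sigma> (A - {i})) ` ?C (i, j) \<subseteq> (A - {i}) \<rightarrow>\<^sub>E B"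
      unfolding image_subset_iff restrict_PiE_iff by auto
    ultimately have "card (?C (i, j)) \<le> card ((A - {i}) \<rightarrow>\<^sub>E B)"
      using assms by (intro card_inj_on_le) (auto simp: finite_PiE)
    also have "\<dots> = card B ^ (card A - 1)"
      using assms ij by (simp add: card_PiE card_Diff_singleton)
    finally have "card (?C p) * card B \<le> card B ^ (card A - 1) * card B"
      unfolding p by (rule mult_right_mono) simp
    also have "\<dots> = card B ^ card A"
      using ij assms by (metis card_gt_0_iff empty_iff power_minus_mult)
    finally show ?thesis .
  qed
  have "{\<sigma> \<in> A \<rightarrow>\<^sub>E B. \<not> inj_on \<sigma> A} \<subseteq> (\<Union>p\<in>?D. ?C p)"
    by (fastforce simp: inj_on_def)
  then have "card {\<sigma> \<in> A \<rightarrow>\<^sub>E B. \<not> inj_on \<sigma> A} \<le> card (\<Union>p\<in>?D. ?C p)"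
    using assms fin by (intro card_mono) auto
  also have "\<dots> \<le> (\<Sum>p\<in>?D. card (?C p))"
    using assms by (intro card_UN_le) auto
  finally have "card {\<sigma> \<in> A \<rightarrow>\<^sub>E B. \<not> inj_on \<sigma> A} * card B \<le> (\<Sum>p\<in>?D. card (?C p) * card B)"
    by (simp flip: sum_distrib_right)
  also have "\<dots> \<le> card ?D * card B ^ card A"
    using sum_bounded_above[of ?D, OF card_C] by simp
  also have "card ?D \<le> (card A)\<^sup>2"
    using assms card_mono[of "A \<times> A" ?D] by (auto simp: power2_eq_square card_cartesian_product)
  finally show ?thesis
    by simp
qed

lemma empirical_frequencies_in_simplex:
  assumes "N \<ge> 1"
  shows "(\<chi> x. real (counting_map N z x) / N) \<in> (prob_simplex :: (real ^ 'x::finite) set)"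
proof -
  have "(\<Sum>x\<in>UNIV. real (counting_map N z x)) = N"
    using counting_map_in_count_vectors[of N z] by (simp add: count_vectors_def flip: of_nat_sum)
  then show ?thesis
    using assms by (auto simp: prob_simplex_def simp flip: sum_divide_distrib)
qed

text \<open>
  Drawing \<open>n\<close> times with replacement from an urn filled with the \<open>N\<close> observations \<open>z\<close> is independent
  sampling from the empirical frequencies of \<open>z\<close>: a sample \<open>y\<close> is drawn by those maps \<open>\<sigma>\<close> that send
  each \<open>k\<close> to one of the positions where \<open>z\<close> shows \<open>y k\<close>.
\<close>
lemma sum_over_draws_with_replacement:
  fixes f :: "(nat \<Rightarrow> 'x::finite) \<Rightarrow> real"
  assumes "N \<ge> 1"
  shows "(\<Sum>\<sigma>\<in>{1..n} \<rightarrow>\<^sub>E {1..N}. f (\<lambda>k\<in>{1..n}. z (\<sigma> k)))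
       = N ^ n * Mn n f (\<chi> x. real (counting_map N z x) / N)"
proof -
  let ?D = "{1..n} \<rightarrow>\<^sub>E {1..N}"
  \<comment> \<open>Choosing \<open>\<sigma>\<close> position by position makes the fibre over \<open>y\<close> a product set.\<close>
  have fibre: "{\<sigma> \<in> ?D. (\<lambda>k\<in>{1..n}. z (\<sigma> k)) = y} = (\<Pi>\<^sub>E k\<in>{1..n}. {j\<in>{1..N}. z j = y k})"
    if "y \<in> samples n" for y
    using that by (fastforce simp: PiE_iff samples_def extensional_def fun_eq_iff)
  have "(\<Sum>\<sigma>\<in>?D. f (\<lambda>k\<in>{1..n}. z (\<sigma> k))) =
      (\<Sum>y\<in>samples n. real (card {\<sigma> \<in> ?D. (\<lambda>k\<in>{1..n}. z (\<sigma> k)) = y}) * f y)"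
    by (rule sum_fun_comp) (simp_all add: finite_PiE image_subset_iff restrict_in_samples[simplified]
        del: restrict_apply)
  also have "\<dots> = (\<Sum>y\<in>samples n. (\<Prod>k=1..n. real (counting_map N z (y k))) * f y)"
    by (rule sum.cong) (simp_all only: fibre card_PiE finite_atLeastAtMost counting_map_def of_nat_prod)
  also have "\<dots> = N ^ n * (\<Sum>y\<in>samples n. f y * (\<Prod>k=1..n. real (counting_map N z (y k)) / N))"
    using assms by (simp add: prod_dividef sum_distrib_left mult.commute)
  finally show ?thesis
    by (simp add: Mn_eq_sum_prod[OF empirical_frequencies_in_simplex[OF assms]])
qed

lemma injection_has_permutation_left_inverse:
  assumes "inj_on \<sigma> A" "\<sigma> ` A \<subseteq> B" "A \<subseteq> B" "finite B"
  obtains \<pi> where "\<pi> permutes B" "\<And>k. k \<in> A \<Longrightarrow> \<pi> (\<sigma> k) = k"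
proof -
  have "card (B - \<sigma> ` A) = card (B - A)"
    using assms by (simp add: card_Diff_subset card_image finite_subset)
  then obtain \<rho> where \<rho>: "bij_betw \<rho> (B - \<sigma> ` A) (B - A)"
    using assms finite_same_card_bij[of "B - \<sigma> ` A" "B - A"] by auto
  define \<pi> where "\<pi> = (\<lambda>j. if j \<in> \<sigma> ` A then inv_into A \<sigma> j else if j \<in> B then \<rho> j else j)"
  have "bij_betw \<pi> (\<sigma> ` A) A"
    using bij_betw_inv_into[of \<sigma> A "\<sigma> ` A"] assms(1)
    by (subst bij_betw_cong[of _ _ "inv_into A \<sigma>"]) (auto simp: \<pi>_def bij_betw_def)
  moreover have "bij_betw \<pi> (B - \<sigma> ` A) (B - A)"
    using \<rho> by (subst bij_betw_cong[of _ _ \<rho>]) (auto simp: \<pi>_def)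
  ultimately have "bij_betw \<pi> (\<sigma> ` A \<union> (B - \<sigma> ` A)) (A \<union> (B - A))"
    by (rule bij_betw_combine) auto
  moreover have "\<sigma> ` A \<union> (B - \<sigma> ` A) = B" "A \<union> (B - A) = B"
    using assms by auto
  ultimately have "\<pi> permutes B"
    using assms(2) by (intro bij_imp_permutes) (auto simp: \<pi>_def)
  moreover have "\<pi> (\<sigma> k) = k" if "k \<in> A" for k
    using assms(1) that by (simp add: \<pi>_def)
  ultimately show thesis
    by (rule that)
qed

text \<open>
  The map \<open>\<sigma>\<close> selects which of the \<open>N\<close> observations \<open>f\<close> looks at, possibly with repetitions; for
  \<open>\<sigma> = id\<close> and \<open>n \<le> N\<close> the result is the cylindrical extension of \<open>f\<close>.
\<close>
definition drawn_gamble ::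
    "nat \<Rightarrow> nat \<Rightarrow> ((nat \<Rightarrow> 'x::finite) \<Rightarrow> real) \<Rightarrow> (nat \<Rightarrow> nat) \<Rightarrow> (nat \<Rightarrow> 'x) \<Rightarrow> real" where
  "drawn_gamble N n f \<sigma> = (\<lambda>z\<in>samples N. f (\<lambda>k\<in>{1..n}. z (\<sigma> k)))"

text \<open>
  A permutation that extends the inverse of \<open>\<sigma>\<close> carries the gamble on the observations \<open>\<sigma> 1, \<dots>, \<sigma> n\<close>
  to the gamble on the first \<open>n\<close> observations, and exchangeability compares the two.
\<close>
lemma exchangeable_draw_without_replacement:
  assumes exch: "exchangeable N P" and "n \<le> N"
    and \<sigma>: "inj_on \<sigma> {1..n}" "\<sigma> ` {1..n} \<subseteq> {1..N}"
  shows "0 \<le> P (\<lambda>z\<in>samples N. drawn_gamble N n f id z - drawn_gamble N n f \<sigma> z)"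
proof -
  obtain \<pi> where \<pi>: "\<pi> permutes {1..N}" "\<And>k. k \<in> {1..n} \<Longrightarrow> \<pi> (\<sigma> k) = k"
    using injection_has_permutation_left_inverse[OF \<sigma>] \<open>n \<le> N\<close> by auto
  have eq: "(\<lambda>k\<in>{1..n}. (\<lambda>j\<in>{1..N}. z (\<pi> j)) (\<sigma> k)) = (\<lambda>k\<in>{1..n}. z (id k))" for z :: "nat \<Rightarrow> 'a"
    by (rule restrict_ext) (use \<sigma>(2) \<pi>(2) in \<open>auto simp: image_subset_iff\<close>)
  have "permute_gamble N \<pi> (drawn_gamble N n f \<sigma>) = drawn_gamble N n f id"
    unfolding permute_gamble_def drawn_gamble_def
    by (rule restrict_ext) (simp only: restrict_in_samples restrict_apply' eq)
  moreover have "drawn_gamble N n f \<sigma> \<in> gambles (samples N)"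
    by (simp add: gambles_finite drawn_gamble_def)
  ultimately show ?thesis
    using exch \<pi>(1) unfolding exchangeable_def by metis
qed

text \<open>
  Decompose \<open>N ^ n\<close> times the extension of \<open>f\<close> into the sum of \<open>drawn_gamble N n f \<sigma>\<close> over all maps
  \<open>\<sigma>\<close> and the sum of the corresponding differences. The first sum is pointwise at least \<open>N ^ n * c\<close>,
  since its values are \<open>N ^ n\<close> times values of \<open>Mn n f\<close> at empirical frequencies. In the second sum
  exchangeability makes every injective \<open>\<sigma>\<close> contribute at least \<open>0\<close>, every other \<open>\<sigma>\<close> contributes
  at least \<open>- 2 * B\<close>, and these other \<open>\<sigma>\<close> are few.
\<close>
lemma prevision_ge_approximate_Mn_bound:
  fixes f :: "(nat \<Rightarrow> 'x::finite) \<Rightarrow> real"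
  assumes coh: "coherent_lower_prevision (samples N) (gambles (samples N)) P"
    and exch: "exchangeable N P" and "n \<le> N" "N \<ge> 1"
    and c: "\<And>\<theta>. \<theta> \<in> prob_simplex \<Longrightarrow> c \<le> Mn n f \<theta>"
    and B: "\<And>z. z \<in> samples n \<Longrightarrow> \<bar>f z\<bar> \<le> B"
  shows "c - 2 * B * n\<^sup>2 / N \<le> P (drawn_gamble N n f id)"
proof -
  let ?D = "{1..n} \<rightarrow>\<^sub>E {1..N}"
  let ?F = "drawn_gamble N n f"
  let ?diff = "\<lambda>\<sigma>. \<lambda>z\<in>samples N. ?F id z - ?F \<sigma> z"
  let ?avg = "\<lambda>z\<in>samples N. \<Sum>\<sigma>\<in>?D. ?F \<sigma> z"
  let ?rest = "\<lambda>z\<in>samples N. \<Sum>\<sigma>\<in>?D. ?diff \<sigma> z"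
  have gamble [simp]: "restrict h (samples N) \<in> gambles (samples N)" for h :: "(nat \<Rightarrow> 'x) \<Rightarrow> real"
    by (simp add: gambles_finite)
  have F [simp]: "?F \<sigma> \<in> gambles (samples N)" for \<sigma>
    by (simp add: drawn_gamble_def)
  have fin [simp]: "finite ?D" and card_D: "card ?D = N ^ n"
    by (simp_all add: finite_PiE card_PiE)
  have "0 \<le> B"
    using B[of "\<lambda>k\<in>{1..n}. undefined"] by (fastforce simp: samples_def)

  have avg: "N ^ n * c \<le> P ?avg"
  proof (rule coherent_ge_lower_bound[OF coh])
    fix z :: "nat \<Rightarrow> 'x" assume z: "z \<in> samples N"
    have "N ^ n * c \<le> N ^ n * Mn n f (\<chi> x. real (counting_map N z x) / N)"
      using c[OF empirical_frequencies_in_simplex[OF \<open>N \<ge> 1\<close>]] by (intro mult_left_mono) auto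
    then show "N ^ n * c \<le> ?avg z"
      using z sum_over_draws_with_replacement[OF \<open>N \<ge> 1\<close>, of f z n] by (simp add: drawn_gamble_def)
  qed auto

  have diff: "(if \<not> inj_on \<sigma> {1..n} then - 2 * B else 0) \<le> P (?diff \<sigma>)" if "\<sigma> \<in> ?D" for \<sigma>
  proof (cases "inj_on \<sigma> {1..n}")
    case True
    then show ?thesis
      using exchangeable_draw_without_replacement[OF exch \<open>n \<le> N\<close> True] that by auto
  next
    case False
    have "- 2 * B \<le> P (?diff \<sigma>)"
    proof (rule coherent_ge_lower_bound[OF coh])
      fix z :: "nat \<Rightarrow> 'x" assume "z \<in> samples N"
      then show "- 2 * B \<le> ?diff \<sigma> z"
        using B[OF restrict_in_samples, of "\<lambda>k. z (id k)"] B[OF restrict_in_samples, of "\<lambda>k. z (\<sigma> k)"]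
        unfolding drawn_gamble_def restrict_apply' abs_le_iff by simp
    qed auto
    with False show ?thesis
      by simp
  qed
  let ?bad = "{\<sigma> \<in> ?D. \<not> inj_on \<sigma> {1..n}}"
  have "real (card ?bad) * N \<le> n\<^sup>2 * N ^ n"
    using card_noninjective_le[of "{1..n}" "{1..N}"] by (simp flip: of_nat_mult of_nat_power)
  then have "real (card ?bad) \<le> n\<^sup>2 * N ^ n / N"
    using \<open>N \<ge> 1\<close> by (simp add: field_simps)
  then have "- 2 * B * (n\<^sup>2 * N ^ n / N) \<le> - 2 * B * card ?bad"
    using \<open>0 \<le> B\<close> by (intro mult_left_mono_neg) auto
  also have "\<dots> = (\<Sum>\<sigma>\<in>?bad. - 2 * B)"
    by simp
  also have "\<dots> = (\<Sum>\<sigma>\<in>?D. if \<not> inj_on \<sigma> {1..n} then - 2 * B else 0)"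
    by (rule sum.inter_filter[OF fin])
  also have "\<dots> \<le> (\<Sum>\<sigma>\<in>?D. P (?diff \<sigma>))"
    by (rule sum_mono) (rule diff)
  also have "\<dots> \<le> P ?rest"
    using coherent_superadditive_sum[OF coh fin, of ?diff] by simp
  finally have rest: "- 2 * B * (n\<^sup>2 * N ^ n / N) \<le> P ?rest" .

  have "(\<lambda>z\<in>samples N. N ^ n * ?F id z) = (\<lambda>z\<in>samples N. ?avg z + ?rest z)"
    by (rule restrict_ext) (simp add: sum_subtractf card_D[simplified])
  then have split: "P (\<lambda>z\<in>samples N. ?avg z + ?rest z) = N ^ n * P (?F id)"
    using coherent_scale[OF coh F, of "N ^ n" id] by simp
  have "N ^ n * (c - 2 * B * n\<^sup>2 / N) = N ^ n * c + - 2 * B * (n\<^sup>2 * N ^ n / N)"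
    by (simp add: algebra_simps)
  also have "\<dots> \<le> P ?avg + P ?rest"
    using avg rest by (rule add_mono)
  also have "\<dots> \<le> N ^ n * P (?F id)"
    unfolding split[symmetric] by (rule coherent_superadditive[OF coh gamble gamble])
  finally have "N ^ n * (c - 2 * B * n\<^sup>2 / N) \<le> N ^ n * P (?F id)" .
  then show ?thesis
    using \<open>N \<ge> 1\<close> by (simp add: mult_le_cancel_left_pos)
qed

section \<open>Comparison through multinomial expectations\<close>

text \<open>
  Time consistency lets \<open>f\<close> be regarded as a gamble on ever more observations, and the error in
  \<open>prevision_ge_approximate_Mn_bound\<close> vanishes in the limit. This is stronger than coherence of
  \<open>P n\<close> alone, because \<open>Mn n f\<close> may stay well above the minimum of \<open>f\<close>.
\<close>
lemma time_consistent_exchangeable_ge_inf_Mn: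
  fixes P :: "nat \<Rightarrow> ((nat \<Rightarrow> 'x::finite) \<Rightarrow> real) \<Rightarrow> real"
  assumes coh: "\<And>n. n \<ge> 1 \<Longrightarrow> coherent_lower_prevision (samples n) (gambles (samples n)) (P n)"
    and exch: "\<And>n. n \<ge> 1 \<Longrightarrow> exchangeable n (P n)"
    and tc: "time_consistent P"
    and "n \<ge> 1" and f: "f \<in> gambles (samples n)"
    and c: "\<And>\<theta>. \<theta> \<in> prob_simplex \<Longrightarrow> c \<le> Mn n f \<theta>"
  shows "c \<le> P n f"
proof -
  define B where "B = (\<Sum>z\<in>samples n. \<bar>f z\<bar>)"
  have B: "\<bar>f z\<bar> \<le> B" if "z \<in> samples n" for z
    unfolding B_def by (rule member_le_sum) (use that in auto)
  have bound: "c - 2 * B * n\<^sup>2 / real N \<le> P n f" if "N \<ge> n" for N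
  proof -
    have "N \<ge> 1"
      using that \<open>n \<ge> 1\<close> by simp
    have "P n f = P (n + (N - n)) (cylindrical_extension n (N - n) f)"
      using tc \<open>n \<ge> 1\<close> f unfolding time_consistent_def by blast
    also have "\<dots> = P N (drawn_gamble N n f id)"
      using that by (simp add: cylindrical_extension_def drawn_gamble_def restrict_def)
    finally show ?thesis
      using prevision_ge_approximate_Mn_bound[OF coh[OF \<open>N \<ge> 1\<close>] exch[OF \<open>N \<ge> 1\<close>] that \<open>N \<ge> 1\<close> c B] by simp
  qed
  have "(\<lambda>N. c - 2 * B * n\<^sup>2 / real N) \<longlonglongrightarrow> c - 0"
    by (intro tendsto_intros lim_const_over_n)
  then show ?thesis
    using bound by (intro LIMSEQ_le_const2[of _ c]) auto
qed

lemma time_consistent_cylindrical_extension: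
  "time_consistent P \<Longrightarrow> n \<ge> 1 \<Longrightarrow> f \<in> gambles (samples n) \<Longrightarrow>
    P (n + k) (cylindrical_extension n k f) = P n f"
  unfolding time_consistent_def by metis

text \<open>
  After extension to the common length \<open>n + m\<close>, the difference of the two gambles has a non-negative
  multinomial expectation and hence a non-negative lower prevision. With equality in \<open>le\<close> this shows
  that \<open>P n f\<close> depends only on the polynomial \<open>Mn n f\<close>.
\<close>
lemma time_consistent_exchangeable_mono_Mn:
  fixes P :: "nat \<Rightarrow> ((nat \<Rightarrow> 'x::finite) \<Rightarrow> real) \<Rightarrow> real"
  assumes coh: "\<And>n. n \<ge> 1 \<Longrightarrow> coherent_lower_prevision (samples n) (gambles (samples n)) (P n)"
    and exch: "\<And>n. n \<ge> 1 \<Longrightarrow> exchangeable n (P n)"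
    and tc: "time_consistent P"
    and nm: "n \<ge> 1" "m \<ge> 1"
    and fg: "f \<in> gambles (samples n)" "g \<in> gambles (samples m)"
    and le: "\<And>\<theta>. \<theta> \<in> prob_simplex \<Longrightarrow> Mn n f \<theta> \<le> Mn m g \<theta>"
  shows "P n f \<le> P m g"
proof -
  let ?N = "n + m"
  define F where "F = cylindrical_extension n m f"
  define G where "G = cylindrical_extension m n g"
  let ?D = "\<lambda>z\<in>samples ?N. G z - F z"
  have gamble: "h \<in> gambles (samples ?N) \<longleftrightarrow> h \<in> extensional (samples ?N)"
    for h :: "(nat \<Rightarrow> 'x) \<Rightarrow> real"
    by (simp add: gambles_finite)
  have F: "F \<in> gambles (samples ?N)" and G: "G \<in> gambles (samples ?N)"
    unfolding gamble by (simp_all add: F_def G_def cylindrical_extension_def add.commute)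
  have Mn_F: "Mn ?N F = Mn n f" and Mn_G: "Mn ?N G = Mn m g"
    using Mn_cylindrical_extension[of n m f] Mn_cylindrical_extension[of m n g]
    by (simp_all add: F_def G_def add.commute)
  have P_F: "P ?N F = P n f" and P_G: "P ?N G = P m g"
    using time_consistent_cylindrical_extension[OF tc nm(1) fg(1), of m]
      time_consistent_cylindrical_extension[OF tc nm(2) fg(2), of n]
    by (simp_all add: F_def G_def add.commute)
  have N: "?N \<ge> 1"
    using nm by simp
  have D: "?D \<in> gambles (samples ?N)"
    unfolding gamble by simp
  have "0 \<le> P ?N ?D"
    by (rule time_consistent_exchangeable_ge_inf_Mn[OF coh exch tc N D])
      (use le in \<open>simp_all add: Mn_diff Mn_F Mn_G del: restrict_apply\<close>)
  then have "P ?N F \<le> P ?N F + P ?N ?D"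
    by simp
  also have "\<dots> \<le> P ?N (\<lambda>z\<in>samples ?N. F z + ?D z)"
    by (rule coherent_superadditive[OF coh[OF N] F D])
  also have "(\<lambda>z\<in>samples ?N. F z + ?D z) = restrict G (samples ?N)"
    by (rule restrict_ext) simp
  also have "\<dots> = G"
    using G unfolding gamble by (rule extensional_restrict)
  finally show ?thesis
    by (simp add: P_F P_G)
qed

section \<open>Polynomial gambles as multinomial expectations\<close>

text \<open>
  On the simplex a linear map is the expectation of its values at the vertices, and sums and products
  are realised on samples of length \<open>n + m\<close>, by a common extension and by independence.
\<close>
lemma real_polynomial_function_eq_Mn:
  fixes p :: "real ^ 'x::finite \<Rightarrow> real"
  assumes "real_polynomial_function p"
  shows "\<exists>n\<ge>1. \<exists>f\<in>gambles (samples n). \<forall>\<theta>\<in>prob_simplex. p \<theta> = Mn n f \<theta>"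
  using assms
proof induction
  case (linear l)
  let ?f = "\<lambda>z\<in>samples 1. l (axis (z 1) 1)"
  have "l \<theta> = Mn 1 ?f \<theta>" if \<theta>: "\<theta> \<in> prob_simplex" for \<theta>
  proof -
    interpret bounded_linear l by fact
    have "l \<theta> = l (\<Sum>x\<in>UNIV. \<theta> $ x *\<^sub>R axis x 1)"
      using basis_expansion[of \<theta>] by (simp add: scalar_mult_eq_scaleR)
    also have "\<dots> = (\<Sum>x\<in>UNIV. l (axis x 1) * \<theta> $ x)"
      by (simp add: sum scaleR mult.commute)
    also have "\<dots> = (\<Sum>z\<in>samples 1. l (axis (z 1) 1) * \<theta> $ z 1)"
      by (rule sum.reindex_bij_witness[where i = "\<lambda>z. z 1" and j = "\<lambda>x. \<lambda>k\<in>{1..1}. x"])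
        (auto simp: samples_def PiE_def extensional_def fun_eq_iff)
    finally show ?thesis
      by (simp add: Mn_eq_sum_prod[OF \<theta>])
  qed
  moreover have "?f \<in> gambles (samples 1)"
    by (simp add: gambles_finite)
  ultimately show ?case
    by blast
next
  case (const c)
  have "(\<lambda>z\<in>samples 1. c) \<in> gambles (samples 1 :: (nat \<Rightarrow> 'x) set)"
    by (simp add: gambles_finite)
  moreover have "\<forall>\<theta>\<in>prob_simplex. c = Mn 1 (\<lambda>z\<in>samples 1. c) \<theta>"
    using Mn_const by metis
  ultimately show ?case
    by blast
next
  case (add p q)
  then obtain n f m g where nm: "n \<ge> 1" "m \<ge> 1"
    and p: "\<forall>\<theta>\<in>prob_simplex. p \<theta> = Mn n f \<theta>" and q: "\<forall>\<theta>\<in>prob_simplex. q \<theta> = Mn m g \<theta>"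
    by blast
  let ?h = "\<lambda>z\<in>samples (n + m). cylindrical_extension n m f z + cylindrical_extension m n g z"
  have "\<forall>\<theta>\<in>prob_simplex. p \<theta> + q \<theta> = Mn (n + m) ?h \<theta>"
    using p q Mn_cylindrical_extension[of n m f] Mn_cylindrical_extension[of m n g]
    by (simp add: Mn_add add.commute del: restrict_apply)
  moreover have "?h \<in> gambles (samples (n + m))" "n + m \<ge> 1"
    using nm by (simp_all add: gambles_finite)
  ultimately show ?case
    by blast
next
  case (mult p q)
  then obtain n f m g where nm: "n \<ge> 1" "m \<ge> 1"
    and p: "\<forall>\<theta>\<in>prob_simplex. p \<theta> = Mn n f \<theta>" and q: "\<forall>\<theta>\<in>prob_simplex. q \<theta> = Mn m g \<theta>"
    by blast
  let ?h = "\<lambda>z\<in>samples (n + m). f (restrict z {1..n}) * g (\<lambda>k\<in>{1..m}. z (n + k))"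
  have "\<forall>\<theta>\<in>prob_simplex. p \<theta> * q \<theta> = Mn (n + m) ?h \<theta>"
    using p q by (simp add: Mn_concat[simplified] del: restrict_apply)
  moreover have "?h \<in> gambles (samples (n + m))" "n + m \<ge> 1"
    using nm by (simp_all add: gambles_finite)
  ultimately show ?case
    by blast
qed

lemma restrict_in_polynomial_gambles:
  "real_polynomial_function p \<Longrightarrow> restrict p prob_simplex \<in> polynomial_gambles"
  by (auto simp: polynomial_gambles_def)

lemma Mn_in_polynomial_gambles: "Mn n f \<in> polynomial_gambles"
proof -
  have "Mn n f = restrict (\<lambda>\<theta>. \<Sum>z\<in>samples n. f z * (\<Prod>k=1..n. \<theta> $ z k)) prob_simplex"
    unfolding Mn_def by (rule restrict_ext) (simp add: prod_counting_map)
  also have "\<dots> \<in> polynomial_gambles"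
    by (intro restrict_in_polynomial_gambles real_polynomial_function_sum
        real_polynomial_function_prod real_polynomial_function.intros(1,2,4)
        bounded_linear_vec_nth) auto
  finally show ?thesis .
qed

lemma polynomial_gambles_eq_Mn:
  "(polynomial_gambles :: (real ^ 'x::finite \<Rightarrow> real) set) =
    {Mn n f | n f. n \<ge> 1 \<and> f \<in> gambles (samples n)}" (is "?V = ?M")
proof
  show "?V \<subseteq> ?M"
  proof
    fix p :: "real ^ 'x \<Rightarrow> real" assume "p \<in> polynomial_gambles"
    then obtain p' where p: "p = restrict p' prob_simplex" and "real_polynomial_function p'"
      by (auto simp: polynomial_gambles_def)
    then obtain n f where nf: "n \<ge> 1" "f \<in> gambles (samples n)"
      and eq: "\<forall>\<theta>\<in>prob_simplex. p' \<theta> = Mn n f \<theta>"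
      using real_polynomial_function_eq_Mn by blast
    have "p = Mn n f"
      by (rule extensionalityI[of _ prob_simplex]) (use p eq Mn_extensional in auto)
    with nf show "p \<in> ?M"
      by blast
  qed
qed (auto intro: Mn_in_polynomial_gambles)

section \<open>The representing lower prevision\<close>

lemma linear_space_polynomial_gambles:
  "linear_space_of_gambles prob_simplex (polynomial_gambles :: (real ^ 'x::finite \<Rightarrow> real) set)"
  unfolding linear_space_of_gambles_def
proof (intro conjI ballI allI subsetI)
  fix p q :: "real ^ 'x \<Rightarrow> real" and c :: real
  assume p: "p \<in> polynomial_gambles"
  then obtain p' where p': "p = restrict p' prob_simplex" "real_polynomial_function p'"
    by (auto simp: polynomial_gambles_def)
  have "(\<lambda>\<theta>\<in>prob_simplex. c * p \<theta>) = (\<lambda>\<theta>\<in>prob_simplex. c * p' \<theta>)"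
    by (rule restrict_ext) (simp add: p')
  also have "\<dots> \<in> polynomial_gambles"
    by (rule restrict_in_polynomial_gambles,
        rule real_polynomial_function.intros(4)[OF real_polynomial_function.intros(2) p'(2)])
  finally show "(\<lambda>\<theta>\<in>prob_simplex. c * p \<theta>) \<in> polynomial_gambles" .
  show "p \<in> gambles prob_simplex"
  proof -
    obtain n f where "p = Mn n f"
      using p polynomial_gambles_eq_Mn by blast
    then show ?thesis
      using Mn_bounded[of _ n f] Mn_extensional[of n f]
      by (auto simp: gambles_def intro!: boundedI[where B = "\<Sum>z\<in>samples n. \<bar>f z\<bar>"])
  qed
  assume "q \<in> polynomial_gambles"
  then obtain q' where q': "q = restrict q' prob_simplex" "real_polynomial_function q'"
    by (auto simp: polynomial_gambles_def)
  have "(\<lambda>\<theta>\<in>prob_simplex. p \<theta> + q \<theta>) = (\<lambda>\<theta>\<in>prob_simplex. p' \<theta> + q' \<theta>)"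
    by (rule restrict_ext) (simp add: p' q')
  also have "\<dots> \<in> polynomial_gambles"
    by (rule restrict_in_polynomial_gambles,
        rule real_polynomial_function.intros(3)[OF p'(2) q'(2)])
  finally show "(\<lambda>\<theta>\<in>prob_simplex. p \<theta> + q \<theta>) \<in> polynomial_gambles" .
next
  show "(\<lambda>\<theta>\<in>prob_simplex. 0) \<in> (polynomial_gambles :: (real ^ 'x \<Rightarrow> real) set)"
    by (rule restrict_in_polynomial_gambles, rule real_polynomial_function.intros(2))
qed

theorem theorem5:
  fixes P :: "nat \<Rightarrow> ((nat \<Rightarrow> 'x::finite) \<Rightarrow> real) \<Rightarrow> real"
  assumes "\<And>n. n \<ge> 1 \<Longrightarrow> coherent_lower_prevision (samples n) (gambles (samples n)) (P n)"
    and "\<And>n. n \<ge> 1 \<Longrightarrow> exchangeable n (P n)"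
    and "time_consistent P"
  shows "\<exists>!R. R \<in> extensional polynomial_gambles \<and>
    coherent_lower_prevision prob_simplex polynomial_gambles R \<and>
    (\<forall>n\<ge>1.
      (\<forall>f\<in>gambles (samples n). P n f = R (Mn n f)) \<and>
      (\<forall>g\<in>gambles (count_vectors n). count_distribution n (P n) g = R (CoMn n g)))"
proof (rule ex_ex1I)
  note coh = assms(1) and exch = assms(2) and tc = assms(3)
  have gamble: "h \<in> gambles (samples n) \<longleftrightarrow> h \<in> extensional (samples n)"
    for n and h :: "(nat \<Rightarrow> 'x) \<Rightarrow> real"
    by (simp add: gambles_finite)
  let ?rep = "\<lambda>p v. \<exists>n\<ge>1. \<exists>f\<in>gambles (samples n). p = Mn n f \<and> v = P n f"
  define R where "R = (\<lambda>p\<in>polynomial_gambles. SOME v. ?rep p v)"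
  have R: "R (Mn n f) = P n f" if "n \<ge> 1" "f \<in> gambles (samples n)" for n f
  proof -
    have "?rep (Mn n f) (P n f)"
      using that by blast
    then have "?rep (Mn n f) (R (Mn n f))"
      unfolding R_def restrict_apply'[OF Mn_in_polynomial_gambles] by (rule someI)
    then obtain m g where mg: "m \<ge> 1" "g \<in> gambles (samples m)" "Mn n f = Mn m g" "R (Mn n f) = P m g"
      by blast
    \<comment> \<open>The choice of the representing sample gamble is immaterial.\<close>
    have "P n f \<le> P m g" "P m g \<le> P n f"
      by (rule time_consistent_exchangeable_mono_Mn[OF coh exch tc]; use that mg in simp)+
    with mg(4) show ?thesis
      by simp
  qed
  have Mn_cases: "\<exists>n f. n \<ge> 1 \<and> f \<in> gambles (samples n) \<and> p = Mn n f"
    if "p \<in> polynomial_gambles" for p :: "real ^ 'x \<Rightarrow> real"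
    using that polynomial_gambles_eq_Mn by blast
  have coh_R: "coherent_lower_prevision prob_simplex polynomial_gambles R"
    unfolding coherent_lower_prevision_def
  proof (intro conjI linear_space_polynomial_gambles ballI allI impI)
    fix p q :: "real ^ 'x \<Rightarrow> real"
    assume p: "p \<in> polynomial_gambles"
    obtain n f where nf: "n \<ge> 1" "f \<in> gambles (samples n)" "p = Mn n f"
      using Mn_cases[OF p] by blast
    show "(INF \<theta>\<in>prob_simplex. p \<theta>) \<le> R p"
    proof -
      have "bounded (p ` prob_simplex)"
        using p linear_space_polynomial_gambles
        by (auto simp: linear_space_of_gambles_def gambles_def)
      then have inf_le: "(INF \<theta>\<in>prob_simplex. p \<theta>) \<le> Mn n f \<theta>" if "\<theta> \<in> prob_simplex" for \<theta>
        unfolding nf(3) using that by (intro cINF_lower bounded_imp_bdd_below)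
      \<comment> \<open>The infimum over the simplex, not over the samples: coherence of \<open>P n\<close> alone would only give
          the minimum of \<open>f\<close>.\<close>
      have "(INF \<theta>\<in>prob_simplex. p \<theta>) \<le> P n f"
        by (rule time_consistent_exchangeable_ge_inf_Mn[OF coh exch tc nf(1,2) inf_le])
      then show ?thesis
        by (simp add: R[OF nf(1,2)] nf(3))
    qed
    show "R (\<lambda>\<theta>\<in>prob_simplex. c * p \<theta>) = c * R p" if "0 \<le> c" for c
    proof -
      have "(\<lambda>\<theta>\<in>prob_simplex. c * p \<theta>) = Mn n (\<lambda>z\<in>samples n. c * f z)"
        by (rule extensionalityI[OF restrict_extensional Mn_extensional])
          (simp add: nf Mn_scale)
      then show ?thesis
        using coherent_scale[OF coh[OF nf(1)] nf(2) that] R[OF nf(1), of "\<lambda>z\<in>samples n. c * f z"]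
          R[OF nf(1,2)] by (simp add: nf(3) gamble del: restrict_apply)
    qed
    assume q: "q \<in> polynomial_gambles"
    obtain m g where mg: "m \<ge> 1" "g \<in> gambles (samples m)" "q = Mn m g"
      using Mn_cases[OF q] by blast
    show "R p + R q \<le> R (\<lambda>\<theta>\<in>prob_simplex. p \<theta> + q \<theta>)"
    proof -
      let ?N = "n + m"
      \<comment> \<open>Bring both gambles to a common sample length, where superadditivity is available.\<close>
      let ?F = "cylindrical_extension n m f" and ?G = "cylindrical_extension m n g"
      have N: "?N \<ge> 1"
        using nf by simp
      have F: "?F \<in> gambles (samples ?N)" and G: "?G \<in> gambles (samples ?N)"
        unfolding gamble by (simp_all add: cylindrical_extension_def add.commute)
      have p: "p = Mn ?N ?F" and q: "q = Mn ?N ?G"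
        using nf mg Mn_cylindrical_extension[of n m f] Mn_cylindrical_extension[of m n g]
        by (simp_all add: add.commute)
      have "(\<lambda>\<theta>\<in>prob_simplex. p \<theta> + q \<theta>) = Mn ?N (\<lambda>z\<in>samples ?N. ?F z + ?G z)"
        by (rule extensionalityI[OF restrict_extensional Mn_extensional]) (simp add: p q Mn_add)
      moreover have "R p = P ?N ?F" "R q = P ?N ?G"
        unfolding p q using N F G by (blast intro: R)+
      moreover have "R (Mn ?N (\<lambda>z\<in>samples ?N. ?F z + ?G z)) = P ?N (\<lambda>z\<in>samples ?N. ?F z + ?G z)"
        by (rule R[OF N]) (simp add: gamble)
      ultimately show ?thesis
        using coherent_superadditive[OF coh[OF N] F G] by simp
    qed
  qed
  have R_CoMn: "count_distribution n (P n) g = R (CoMn n g)"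
    if "n \<ge> 1" "g \<in> gambles (count_vectors n)" for n g
  proof -
    have "(\<lambda>z\<in>samples n. g (counting_map n z)) \<in> gambles (samples n)"
      by (simp add: gamble)
    then show ?thesis
      using that by (simp add: count_distribution_def CoMn_eq_Mn R[OF that(1)])
  qed
  show "\<exists>R. R \<in> extensional polynomial_gambles \<and>
    coherent_lower_prevision prob_simplex polynomial_gambles R \<and>
    (\<forall>n\<ge>1.
      (\<forall>f\<in>gambles (samples n). P n f = R (Mn n f)) \<and>
      (\<forall>g\<in>gambles (count_vectors n). count_distribution n (P n) g = R (CoMn n g)))"
  proof (intro exI[of _ R] conjI allI impI ballI coh_R)
    show "R \<in> extensional polynomial_gambles"
      by (simp add: R_def)
  qed (simp_all add: R R_CoMn)
next
  fix R R' :: "(real ^ 'x \<Rightarrow> real) \<Rightarrow> real"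
  assume R: "R \<in> extensional polynomial_gambles \<and>
    coherent_lower_prevision prob_simplex polynomial_gambles R \<and>
    (\<forall>n\<ge>1.
      (\<forall>f\<in>gambles (samples n). P n f = R (Mn n f)) \<and>
      (\<forall>g\<in>gambles (count_vectors n). count_distribution n (P n) g = R (CoMn n g)))"
  assume R': "R' \<in> extensional polynomial_gambles \<and>
    coherent_lower_prevision prob_simplex polynomial_gambles R' \<and>
    (\<forall>n\<ge>1.
      (\<forall>f\<in>gambles (samples n). P n f = R' (Mn n f)) \<and>
      (\<forall>g\<in>gambles (count_vectors n). count_distribution n (P n) g = R' (CoMn n g)))"
  show "R = R'"
  proof (rule extensionalityI)
    fix p :: "real ^ 'x \<Rightarrow> real" assume "p \<in> polynomial_gambles"
    then obtain n f where "n \<ge> 1" "f \<in> gambles (samples n)" "p = Mn n f"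
      using polynomial_gambles_eq_Mn by blast
    then show "R p = R' p"
      using R R' by metis
  qed (use R R' in blast)+
qed

end
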